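(* In the binary random graph affiliation mixture model with $Q=2$ groups, if $\alpha\ne\beta$ then the parameters $\alpha,\beta$ and $\{\pi_1,\pi_2=1-\pi_1\}$ (the latter up to label swapping) are strictly identifiable from the joint distribution of $K_3$; that is, any two parameter values $(\pi_1,\alpha,\beta)$, $(\pi_1',\alpha',\beta')$ with $\alpha\neq\beta$, $\alpha'\ne\beta'$ inducing the same law of $K_3$ satisfy $\alpha=\alpha'$, $\beta=\beta'$, and $\pi_1'\in\{\pi_1,1-\pi_1\}$.
   Context: Random graph mixture model: nodes have i.i.d. latent groups $Z_i\in\{1,\dots,Q\}$ with $\pi_q=\mathbb P(Z_i=q)\in(0,1)$, $\sum_q\pi_q=1$; edge variables $X_{ij}$ ($i<j$) are conditionally independent given all $Z$'s, with law of $X_{ij}$ depending only on $(Z_i,Z_j)$. Binary affiliation model: $X_{ij}\in\{0,1\}$ with $\mathbb P(X_{ij}=1\mid Z_i=q,Z_j=l)=\alpha$ if $q=l$ and $=\beta$ if $q\ne l$. $K_n$ denotes the collection of the $\binom n2$ edge variables among a set of $n$ nodes. *)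

theory Defs
  imports Complex_Main
begin

text \<open>Binary affiliation model with Q = 2 groups. A latent group is encoded as a bool
  (True = group 1, False = group 2); pi1 = P(Z_i = group 1), pi2 = 1 - pi1.\<close>

definition grp_prob :: "real \<Rightarrow> bool \<Rightarrow> real" where
  "grp_prob pi1 g = (if g then pi1 else 1 - pi1)"

definition conn_prob :: "real \<Rightarrow> real \<Rightarrow> bool \<Rightarrow> bool \<Rightarrow> real" where
  "conn_prob \<alpha> \<beta> g h = (if g = h then \<alpha> else \<beta>)"

definition edge_lik :: "real \<Rightarrow> bool \<Rightarrow> real" where
  "edge_lik p x = (if x then p else 1 - p)"

definition K3_law :: "real \<Rightarrow> real \<Rightarrow> real \<Rightarrow> bool \<Rightarrow> bool \<Rightarrow> bool \<Rightarrow> real" where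
  "K3_law pi1 \<alpha> \<beta> x12 x13 x23 =
     (\<Sum>z1\<in>(UNIV::bool set). \<Sum>z2\<in>(UNIV::bool set). \<Sum>z3\<in>(UNIV::bool set).
        grp_prob pi1 z1 * grp_prob pi1 z2 * grp_prob pi1 z3
        * edge_lik (conn_prob \<alpha> \<beta> z1 z2) x12
        * edge_lik (conn_prob \<alpha> \<beta> z1 z3) x13
        * edge_lik (conn_prob \<alpha> \<beta> z2 z3) x23)"

end

theory Submission
  imports Defs
begin

(* Write t = (2 pi1 - 1)^2 \<in> [0,1) for the label-invariant separation of the
   group proportions and u = alpha - beta for the affiliation contrast.  Three
   functionals of the law of K_3 are computed in closed form: the edge
   probability m1 = beta + u (1+t)/2, and the two "cumulants"
     V = P(X12 = X13 = 1) - m1^2 = t (1-t) u^2 / 4,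
     W = P(X12 = X13 = X23 = 1) - m1^3 - 3 m1 V = (1-t)^2 (1+2t) u^3 / 8.
   They satisfy W^2 t^3 = (1-t)(1+2t)^2 V^3, and (1-t)(1+2t)^2 / t^3 is strictly
   decreasing on (0,1), so (V,W) determines t and then u (via u^3).  Finally m1
   gives beta, hence alpha, and t = t' gives pi1' \<in> {pi1, 1 - pi1}. *)

text \<open>For an exchangeable law (as in
  the model) edge_moment P = P(X12 = 1) and cherry_moment P = P(X12 = X13 = 1);
  the definitions use one representative configuration per symmetry class.\<close>

definition edge_moment :: "(bool \<Rightarrow> bool \<Rightarrow> bool \<Rightarrow> real) \<Rightarrow> real" where
  "edge_moment P = P True False False + 2 * P True True False + P True True True"

definition cherry_moment :: "(bool \<Rightarrow> bool \<Rightarrow> bool \<Rightarrow> real) \<Rightarrow> real" where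
  "cherry_moment P = P True True False + P True True True"

definition triangle_moment :: "(bool \<Rightarrow> bool \<Rightarrow> bool \<Rightarrow> real) \<Rightarrow> real" where
  "triangle_moment P = P True True True"

text \<open>Second and third cumulant-type combinations; they are free of beta.\<close>

definition cumulant2 :: "(bool \<Rightarrow> bool \<Rightarrow> bool \<Rightarrow> real) \<Rightarrow> real" where
  "cumulant2 P = cherry_moment P - (edge_moment P)\<^sup>2"

definition cumulant3 :: "(bool \<Rightarrow> bool \<Rightarrow> bool \<Rightarrow> real) \<Rightarrow> real" where
  "cumulant3 P = triangle_moment P - (edge_moment P) ^ 3 - 3 * edge_moment P * cumulant2 P"

lemma edge_moment_K3:
  "edge_moment (K3_law p a b) = b + (a - b) * (1 + (2*p - 1)\<^sup>2) / 2"
  by (simp add: edge_moment_def K3_law_def grp_prob_def conn_prob_def edge_lik_def UNIV_bool)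
     algebra

lemma cherry_moment_K3:
  "cherry_moment (K3_law p a b) =
     b\<^sup>2 + b * (a - b) * (1 + (2*p - 1)\<^sup>2) + (a - b)\<^sup>2 * (1 + 3 * (2*p - 1)\<^sup>2) / 4"
  by (simp add: cherry_moment_def K3_law_def grp_prob_def conn_prob_def edge_lik_def UNIV_bool)
     algebra

lemma triangle_moment_K3:
  "triangle_moment (K3_law p a b) =
     (1 + 3 * (2*p - 1)\<^sup>2) / 4 * a ^ 3 + 3 * (1 - (2*p - 1)\<^sup>2) / 4 * a * b\<^sup>2"
  by (simp add: triangle_moment_def K3_law_def grp_prob_def conn_prob_def edge_lik_def UNIV_bool)
     algebra

lemma cumulant2_K3:
  fixes p a b :: real
  defines "t \<equiv> (2*p - 1)\<^sup>2"
  shows "cumulant2 (K3_law p a b) = t * (1 - t) * (a - b)\<^sup>2 / 4"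
  unfolding cumulant2_def edge_moment_K3 cherry_moment_K3 t_def by algebra

lemma cumulant3_K3:
  fixes p a b :: real
  defines "t \<equiv> (2*p - 1)\<^sup>2"
  shows "cumulant3 (K3_law p a b) = (1 - t)\<^sup>2 * (1 + 2*t) * (a - b) ^ 3 / 8"
  unfolding cumulant3_def cumulant2_K3 edge_moment_K3 triangle_moment_K3 t_def by algebra

text \<open>The ratio (1-t)(1+2t)^2 / t^3 is strictly decreasing on (0,1), stated
  in cross-multiplied form: this is what makes the cumulants determine t.\<close>

lemma separation_ratio_strict_decreasing:
  fixes s t :: real
  assumes "0 < s" "s < t" "t < 1"
  shows "(1 - t) * (1 + 2*t)\<^sup>2 * s ^ 3 < (1 - s) * (1 + 2*s)\<^sup>2 * t ^ 3"
proof -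
  have "(1 + 2*t) * s < (1 + 2*s) * t"
    using assms by (simp add: algebra_simps)
  then have sq: "((1 + 2*t) * s)\<^sup>2 < ((1 + 2*s) * t)\<^sup>2"
    using assms by (intro power_strict_mono) auto
  have cube: "((1 + 2*t) * s)\<^sup>2 * s < ((1 + 2*s) * t)\<^sup>2 * t"
    using sq assms by (intro mult_strict_mono) auto
  have "(1 - t) * (((1 + 2*t) * s)\<^sup>2 * s) < (1 - s) * (((1 + 2*s) * t)\<^sup>2 * t)"
    using assms by (intro mult_strict_mono[OF _ cube]) auto
  then show ?thesis
    by (simp add: algebra_simps power2_eq_square power3_eq_cube)
qed

text \<open>The two cumulants, as functions of the separation t \<in> [0,1) and a nonzero
  contrast u, determine t: the second cumulant vanishes exactly when t = 0, and
  otherwise the scale-free ratio W^2 / V^3 = (1-t)(1+2t)^2 / t^3 pins t down.\<close>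

lemma cumulants_determine_separation:
  fixes t t' u u' :: real
  assumes t: "0 \<le> t" "t < 1" and t': "0 \<le> t'" "t' < 1" and u: "u \<noteq> 0" "u' \<noteq> 0"
    and V: "t * (1 - t) * u\<^sup>2 / 4 = t' * (1 - t') * u'\<^sup>2 / 4"
    and W: "(1 - t)\<^sup>2 * (1 + 2*t) * u ^ 3 / 8 = (1 - t')\<^sup>2 * (1 + 2*t') * u' ^ 3 / 8"
  shows "t = t'"
proof (cases "t = 0 \<or> t' = 0")
  case True
  then show ?thesis using V t t' u by auto
next
  case False
  then have pos: "0 < t" "0 < t'" using t t' by auto
  define v where "v = t * (1 - t) * u\<^sup>2 / 4"
  define w where "w = (1 - t)\<^sup>2 * (1 + 2*t) * u ^ 3 / 8"
  have "v > 0" unfolding v_def using pos t u by simp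
  have ratio: "w\<^sup>2 * t ^ 3 = (1 - t) * (1 + 2*t)\<^sup>2 * v ^ 3"
    unfolding v_def w_def by (simp add: field_simps eval_nat_numeral)
  have ratio': "w\<^sup>2 * t' ^ 3 = (1 - t') * (1 + 2*t')\<^sup>2 * v ^ 3"
    unfolding v_def w_def V W by (simp add: field_simps eval_nat_numeral)
  have "(1 - t) * (1 + 2*t)\<^sup>2 * t' ^ 3 * v ^ 3 = (1 - t') * (1 + 2*t')\<^sup>2 * t ^ 3 * v ^ 3"
    using arg_cong[OF ratio, of "\<lambda>x. x * t' ^ 3"] arg_cong[OF ratio', of "\<lambda>x. x * t ^ 3"]
    by (simp add: algebra_simps)
  then have eq: "(1 - t) * (1 + 2*t)\<^sup>2 * t' ^ 3 = (1 - t') * (1 + 2*t')\<^sup>2 * t ^ 3"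
    using \<open>v > 0\<close> by simp
  show ?thesis
  proof (rule linorder_cases[of t t'])
    assume "t < t'"
    then show ?thesis
      using separation_ratio_strict_decreasing[OF pos(1) _ t'(2)] eq by simp
  next
    assume "t' < t"
    then show ?thesis
      using separation_ratio_strict_decreasing[OF pos(2) _ t(2)] eq by simp
  qed
qed

lemma K3_law_determines_separation_and_contrast:
  fixes p a b p' a' b' :: real
  assumes p: "0 < p" "p < 1" and p': "0 < p'" "p' < 1" and "a \<noteq> b" "a' \<noteq> b'"
    and law: "K3_law p a b = K3_law p' a' b'"
  shows "(2*p - 1)\<^sup>2 = (2*p' - 1)\<^sup>2 \<and> a - b = a' - b'"
proof -
  define t where "t = (2*p - 1)\<^sup>2"
  define t' where "t' = (2*p' - 1)\<^sup>2"
  have t_range: "0 \<le> t" "t < 1" "0 \<le> t'" "t' < 1"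
    unfolding t_def t'_def using p p' by (auto simp: abs_square_less_1)
  have V: "t * (1 - t) * (a - b)\<^sup>2 / 4 = t' * (1 - t') * (a' - b')\<^sup>2 / 4"
    using arg_cong[OF law, of cumulant2] unfolding t_def t'_def cumulant2_K3 .
  have W: "(1 - t)\<^sup>2 * (1 + 2*t) * (a - b) ^ 3 / 8 = (1 - t')\<^sup>2 * (1 + 2*t') * (a' - b') ^ 3 / 8"
    using arg_cong[OF law, of cumulant3] unfolding t_def t'_def cumulant3_K3 .
  have "t = t'"
    using cumulants_determine_separation[OF t_range _ _ V W] assms by simp
  moreover have "(1 - t)\<^sup>2 * (1 + 2*t) \<noteq> 0"
    using t_range by simp
  ultimately have "(a - b) ^ 3 = (a' - b') ^ 3"
    using W by simp
  then have "a - b = a' - b'"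
    by (metis odd_real_root_power_cancel odd_numeral)
  with \<open>t = t'\<close> show ?thesis
    unfolding t_def t'_def by simp
qed

theorem corollary1:
  fixes pi1 \<alpha> \<beta> pi1' \<alpha>' \<beta>' :: real
  assumes "0 < pi1" "pi1 < 1" "0 \<le> \<alpha>" "\<alpha> \<le> 1" "0 \<le> \<beta>" "\<beta> \<le> 1" "\<alpha> \<noteq> \<beta>"
    and "0 < pi1'" "pi1' < 1" "0 \<le> \<alpha>'" "\<alpha>' \<le> 1" "0 \<le> \<beta>'" "\<beta>' \<le> 1" "\<alpha>' \<noteq> \<beta>'"
    and "K3_law pi1 \<alpha> \<beta> = K3_law pi1' \<alpha>' \<beta>'"
  shows "\<alpha> = \<alpha>' \<and> \<beta> = \<beta>' \<and> (pi1' = pi1 \<or> pi1' = 1 - pi1)"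
proof -
  note law = assms(15)
  obtain sep: "(2*pi1 - 1)\<^sup>2 = (2*pi1' - 1)\<^sup>2" and contrast: "\<alpha> - \<beta> = \<alpha>' - \<beta>'"
    using K3_law_determines_separation_and_contrast[OF assms(1,2,8,9,7,14) law] by blast
  have "edge_moment (K3_law pi1 \<alpha> \<beta>) = edge_moment (K3_law pi1' \<alpha>' \<beta>')"
    using law by simp
  then have "\<beta> = \<beta>'"
    unfolding edge_moment_K3 sep contrast by simp
  moreover have "\<alpha> = \<alpha>'"
    using contrast \<open>\<beta> = \<beta>'\<close> by simp
  moreover have "pi1' = pi1 \<or> pi1' = 1 - pi1"
    using sep by (auto simp: power2_eq_iff)
  ultimately show ?thesis
    by blast
qed

end
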